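(* Let $(J,\mathcal{A})$ be a standard Borel space, let $v:J\times J\to\mathbb{R}_+$ be a bounded measurable function, let $\psi$ be a finite nonnegative measure on $\mathcal{A}\times\mathcal{A}$, and let $\sigma,\tau$ be finite nonnegative measures on $\mathcal{A}$ with $\sigma(J)=\tau(J)$. There is a $\sigma$-$\tau$ flow $\varphi$ with $\varphi\le\psi$ and $\varphi(v)=1$ if and only if \[ \psi\bigl(|f(y)-f(x)+b\,v(x,y)|_+\bigr)\ge\tau(f)-\sigma(f)+b \] for every bounded measurable function $f:J\to\mathbb{R}$ and every $b\in\{-1,0,1\}$ (here the left side is the $\psi$-integral of the function $(x,y)\mapsto|f(y)-f(x)+bv(x,y)|_+$).
   Context: A $\sigma$-$\tau$ flow is a finite nonnegative measure $\varphi$ on $\mathcal{A}\times\mathcal{A}$ with $\varphi^1-\varphi^2=\sigma-\tau$, where $\varphi^1(A)=\varphi(A\times J)$, $\varphi^2(A)=\varphi(J\times A)$. $\mu(g)=\int g\,d\mu$, $|t|_+=\max(t,0)$, and $\varphi\le\psi$ is setwise. *)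

theory Defs
  imports "HOL-Analysis.Analysis"
begin

text \<open>
  A measurable space \<open>(J, \<A>)\<close> is represented by a measure \<open>M\<close> with \<open>J = space M\<close> and
  \<open>\<A> = sets M\<close>; the measure carried by \<open>M\<close> itself is never used. The space may be empty.
\<close>

definition standard_borel_space :: "'a measure \<Rightarrow> bool" where
  "standard_borel_space M \<longleftrightarrow>
     (\<exists>X. completely_metrizable_space X \<and> separable_space X \<and> topspace X = space M \<and>
          sets M = sigma_sets (topspace X) {U. openin X U})"

definition finite_measure_on :: "'a measure \<Rightarrow> 'a measure \<Rightarrow> bool" where
  "finite_measure_on M \<mu> \<longleftrightarrow> sets \<mu> = sets M \<and> finite_measure \<mu>"

definition bounded_measurable :: "'a measure \<Rightarrow> ('a \<Rightarrow> real) \<Rightarrow> bool" where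
  "bounded_measurable M f \<longleftrightarrow> f \<in> borel_measurable M \<and> bounded (f ` space M)"

text \<open>The difference of marginals is a signed measure, hence the real-valued \<^const>\<open>measure\<close>;
  all the measures involved are finite.\<close>

definition flow :: "'a measure \<Rightarrow> 'a measure \<Rightarrow> 'a measure \<Rightarrow> ('a \<times> 'a) measure \<Rightarrow> bool" where
  "flow M \<sigma> \<tau> \<phi> \<longleftrightarrow>
     finite_measure_on (M \<Otimes>\<^sub>M M) \<phi> \<and>
     (\<forall>A\<in>sets M. measure \<phi> (A \<times> space M) - measure \<phi> (space M \<times> A) = measure \<sigma> A - measure \<tau> A)"

definition setwise_le :: "'a measure \<Rightarrow> 'a measure \<Rightarrow> bool" where
  "setwise_le \<mu> \<nu> \<longleftrightarrow> (\<forall>A\<in>sets \<nu>. emeasure \<mu> A \<le> emeasure \<nu> A)"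

definition pos_part :: "real \<Rightarrow> real" where
  "pos_part t = max t 0"

end

theory Submission
  imports Defs "HOL-Library.Function_Algebras"
begin

text \<open>
  The functional \<open>L (f, b) = \<tau>(f) - \<sigma>(f) + b\<close> is linear in \<open>(f, b)\<close>, and by homogeneity the condition says
  that it is dominated by \<open>p u = \<psi>(|u|\<^sub>+)\<close> at \<open>u = f(y) - f(x) + b v\<close> for all real \<open>b\<close>. The
  Hahn-Banach theorem in its Mazur-Orlicz form then yields a linear functional \<open>m \<le> p\<close> on the bounded
  measurable functions with \<open>m (f(y) - f(x) + b v) = L (f, b)\<close>. Domination by \<open>p\<close> makes
  \<open>A \<mapsto> m(1\<^sub>A)\<close> nonnegative and at most \<open>\<psi>\<close>, hence countably additive: this is the required flow.
\<close>

subsection \<open>Sublinear functionals and the Mazur-Orlicz theorem\<close>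

text \<open>Homogeneity is demanded only as an inequality for positive \<open>c\<close>, the form
  that passes readily to infima. On a subspace, applying it to \<open>inverse c\<close> as well
  recovers equality.\<close>

definition sublinear_on :: "'v::real_vector set \<Rightarrow> ('v \<Rightarrow> real) \<Rightarrow> bool" where
  "sublinear_on V p \<longleftrightarrow> (\<forall>u\<in>V. \<forall>w\<in>V. p (u + w) \<le> p u + p w) \<and>
     (\<forall>c>0. \<forall>u\<in>V. p (c *\<^sub>R u) \<le> c * p u)"

lemma sublinear_on_add: "sublinear_on V p \<Longrightarrow> u \<in> V \<Longrightarrow> w \<in> V \<Longrightarrow> p (u + w) \<le> p u + p w"
  by (auto simp: sublinear_on_def)

lemma sublinear_on_scale_le: "sublinear_on V p \<Longrightarrow> c > 0 \<Longrightarrow> u \<in> V \<Longrightarrow> p (c *\<^sub>R u) \<le> c * p u"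
  by (auto simp: sublinear_on_def)

lemma sublinear_on_0:
  assumes "subspace V" "sublinear_on V p"
  shows "p 0 = 0"
proof -
  have "0 \<in> V" using assms(1) by (rule subspace_0)
  \<comment> \<open>Subadditivity at 0 gives \<open>p 0 \<ge> 0\<close>, and scaling by 1/2 gives
    \<open>p 0 \<le> p 0 / 2\<close>.\<close>
  then show ?thesis
    using sublinear_on_add[OF assms(2), of 0 0] sublinear_on_scale_le[OF assms(2), of "1/2" 0] by simp
qed

lemma sublinear_on_scale:
  assumes V: "subspace V" and p: "sublinear_on V p" and c: "c \<ge> 0" and u: "u \<in> V"
  shows "p (c *\<^sub>R u) = c * p u"
proof (cases "c = 0")
  case True
  then show ?thesis using sublinear_on_0[OF V p] by simp
next
  case False
  with c have c: "c > 0" by simp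
  have "p (inverse c *\<^sub>R (c *\<^sub>R u)) \<le> inverse c * p (c *\<^sub>R u)"
    using c u V by (intro sublinear_on_scale_le[OF p]) (auto intro: subspace_scale)
  then have "c * p u \<le> p (c *\<^sub>R u)"
    using c by (simp add: field_simps)
  with sublinear_on_scale_le[OF p c u] show ?thesis by simp
qed

lemma sublinear_on_ge:
  assumes V: "subspace V" and p: "sublinear_on V p" and u: "u \<in> V"
  shows "- p (- u) \<le> p u"
  using sublinear_on_add[OF p u subspace_neg[OF V u]] sublinear_on_0[OF V p] by simp

text \<open>The functional \<open>q u\<close> is the infimum of \<open>p (u + A k) - L k\<close>
  over \<open>k\<close>. At \<open>u = - A k\<close> the bound becomes \<open>- L k\<close>, so a
  linear functional below \<open>q\<close> is at least \<open>L k\<close> at \<open>A k\<close>.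
  \<open>K\<close> is a convex cone, so that both a ray and a subspace can serve.\<close>

lemma sublinear_on_lower:
  fixes p :: "'v::real_vector \<Rightarrow> real" and A :: "'k::real_vector \<Rightarrow> 'v"
  assumes V: "subspace V" and p: "sublinear_on V p"
    and K0: "0 \<in> K"
    and Kadd: "\<And>k l. k \<in> K \<Longrightarrow> l \<in> K \<Longrightarrow> k + l \<in> K"
    and Kscale: "\<And>c k. c > 0 \<Longrightarrow> k \<in> K \<Longrightarrow> c *\<^sub>R k \<in> K"
    and AV: "\<And>k. k \<in> K \<Longrightarrow> A k \<in> V"
    and Aadd: "\<And>k l. k \<in> K \<Longrightarrow> l \<in> K \<Longrightarrow> A (k + l) = A k + A l"
    and Ascale: "\<And>c k. c > 0 \<Longrightarrow> k \<in> K \<Longrightarrow> A (c *\<^sub>R k) = c *\<^sub>R A k"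
    and Ladd: "\<And>k l. k \<in> K \<Longrightarrow> l \<in> K \<Longrightarrow> L (k + l) = L k + L l"
    and Lscale: "\<And>c k. c > 0 \<Longrightarrow> k \<in> K \<Longrightarrow> L (c *\<^sub>R k) = c * L k"
    and dom: "\<And>k. k \<in> K \<Longrightarrow> L k \<le> p (A k)"
  obtains q where "sublinear_on V q" "\<And>u k. u \<in> V \<Longrightarrow> k \<in> K \<Longrightarrow> q u \<le> p (u + A k) - L k"
proof
  define q where "q = (\<lambda>u. INF k\<in>K. p (u + A k) - L k)"
  \<comment> \<open>Domination of \<open>L\<close> keeps the infimum finite:
    \<open>L k \<le> p (A k) \<le> p (u + A k) + p (- u)\<close>.\<close>
  have bdd: "bdd_below ((\<lambda>k. p (u + A k) - L k) ` K)" if u: "u \<in> V" for u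
  proof (rule bdd_belowI2)
    fix k assume k: "k \<in> K"
    have "p (A k) = p ((u + A k) + (- u))" by simp
    also have "\<dots> \<le> p (u + A k) + p (- u)"
      using u k V AV by (intro sublinear_on_add[OF p]) (auto intro: subspace_add subspace_neg)
    finally show "- p (- u) \<le> p (u + A k) - L k" using dom[OF k] by simp
  qed
  show le: "q u \<le> p (u + A k) - L k" if "u \<in> V" "k \<in> K" for u k
    unfolding q_def using bdd[OF that(1)] that(2) by (rule cINF_lower)
  have ge: "c \<le> q u" if "\<And>k. k \<in> K \<Longrightarrow> c \<le> p (u + A k) - L k" for c u
    unfolding q_def using K0 that by (intro cINF_greatest) auto
  show "sublinear_on V q"
    unfolding sublinear_on_def
  proof (intro conjI ballI allI impI)
    fix u w assume u: "u \<in> V" and w: "w \<in> V"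
    \<comment> \<open>For independent \<open>k\<close> and \<open>l\<close>, the sum
      \<open>k + l\<close> is a competitor in the infimum defining \<open>q (u + w)\<close>.\<close>
    have *: "q (u + w) \<le> (p (u + A k) - L k) + (p (w + A l) - L l)" if k: "k \<in> K" and l: "l \<in> K" for k l
    proof -
      have "q (u + w) \<le> p (u + w + A (k + l)) - L (k + l)"
        using u w V k l Kadd by (intro le) (auto intro: subspace_add)
      also have "u + w + A (k + l) = (u + A k) + (w + A l)"
        using k l by (simp add: Aadd)
      also have "p \<dots> \<le> p (u + A k) + p (w + A l)"
        using u w V k l AV by (intro sublinear_on_add[OF p]) (auto intro: subspace_add)
      finally show ?thesis using k l by (simp add: Ladd)
    qed
    \<comment> \<open>The infima over \<open>k\<close> and \<open>l\<close> are taken one at a time,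
      with the remaining terms moved to the left.\<close>
    have "q (u + w) - q w \<le> q u"
    proof (rule ge)
      fix k assume k: "k \<in> K"
      have "q (u + w) - (p (u + A k) - L k) \<le> q w"
        using *[OF k] by (intro ge) (simp add: algebra_simps)
      then show "q (u + w) - q w \<le> p (u + A k) - L k" by simp
    qed
    then show "q (u + w) \<le> q u + q w" by simp
  next
    fix c :: real and u assume c: "c > 0" and u: "u \<in> V"
    \<comment> \<open>Each competitor \<open>k\<close> for \<open>u\<close> yields the competitor
      \<open>c *\<^sub>R k\<close> for \<open>c *\<^sub>R u\<close>.\<close>
    have "inverse c * q (c *\<^sub>R u) \<le> q u"
    proof (rule ge)
      fix k assume k: "k \<in> K"
      have "q (c *\<^sub>R u) \<le> p (c *\<^sub>R u + A (c *\<^sub>R k)) - L (c *\<^sub>R k)"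
        using c u k V Kscale by (intro le) (auto intro: subspace_scale)
      also have "\<dots> = p (c *\<^sub>R (u + A k)) - c * L k"
        using c k by (simp add: Ascale Lscale scaleR_add_right)
      also have "\<dots> = c * (p (u + A k) - L k)"
        using c u k V AV by (subst sublinear_on_scale[OF V p]) (auto intro: subspace_add simp: algebra_simps)
      finally show "inverse c * q (c *\<^sub>R u) \<le> p (u + A k) - L k"
        using c by (simp add: field_simps)
    qed
    then show "q (c *\<^sub>R u) \<le> c * q u" using c by (simp add: field_simps)
  qed
qed

text \<open>A minimal sublinear functional is linear, so no one-dimensional extension step is needed.\<close>

lemma sublinear_on_dominates_linear:
  fixes p :: "'v::real_vector \<Rightarrow> real"
  assumes V: "subspace V" and p: "sublinear_on V p"
  obtains m where "\<And>u. u \<in> V \<Longrightarrow> m u \<le> p u"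
    "\<And>u w. u \<in> V \<Longrightarrow> w \<in> V \<Longrightarrow> m (u + w) = m u + m w"
    "\<And>c u. u \<in> V \<Longrightarrow> m (c *\<^sub>R u) = c * m u"
proof -
  \<comment> \<open>Vanishing off \<open>V\<close> makes the pointwise order on total functions
    agree with the order on \<open>V\<close>, so minimality in \<open>Q\<close> concerns only values
    on \<open>V\<close>.\<close>
  define Q where "Q = {m. sublinear_on V m \<and> (\<forall>u\<in>V. m u \<le> p u) \<and> (\<forall>u. u \<notin> V \<longrightarrow> m u = 0)}"
  have restrict: "(\<lambda>u. if u \<in> V then m u else 0) \<in> Q"
    if m: "sublinear_on V m" and le: "\<And>u. u \<in> V \<Longrightarrow> m u \<le> p u" for m
    using m le V by (auto simp: Q_def sublinear_on_def subspace_add subspace_scale)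
  \<comment> \<open>Zorn's lemma is applied to the reversed order, so its maximal element is a
    minimal functional.\<close>
  have "\<exists>m\<in>Q. \<forall>a\<in>Q. a \<le> m \<longrightarrow> a = m"
  proof (rule predicate_Zorn[where P = "\<lambda>x y. y \<le> x"])
    show "partial_order_on Q (relation_of (\<lambda>x y. y \<le> x) Q)"
      by (auto simp: partial_order_on_def preorder_on_def refl_on_def trans_def antisym_def relation_of_def)
  next
    fix C assume "C \<in> Chains (relation_of (\<lambda>x y. y \<le> x) Q)"
    then have CQ: "C \<subseteq> Q" and chain: "\<And>a b. a \<in> C \<Longrightarrow> b \<in> C \<Longrightarrow> a \<le> b \<or> b \<le> a"
      by (auto simp: Chains_def relation_of_def)
    show "\<exists>m\<in>Q. \<forall>a\<in>C. m \<le> a"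
    proof (cases "C = {}")
      case True
      then show ?thesis using restrict[OF p] by auto
    next
      case False
      define i where "i = (\<lambda>u. INF m\<in>C. m u)"
      \<comment> \<open>All members of the chain share the lower bound
        \<open>- p (- u) \<le> - m (- u) \<le> m u\<close>, so their pointwise infimum is
        finite.\<close>
      have bdd: "bdd_below ((\<lambda>m. m u) ` C)" if u: "u \<in> V" for u
      proof (rule bdd_belowI2)
        fix m assume "m \<in> C"
        then have m: "sublinear_on V m" "\<And>u. u \<in> V \<Longrightarrow> m u \<le> p u" using CQ by (auto simp: Q_def)
        show "- p (- u) \<le> m u"
          using sublinear_on_ge[OF V m(1) u] m(2)[OF subspace_neg[OF V u]] by simp
      qed
      have le: "i u \<le> m u" if "u \<in> V" "m \<in> C" for u m
        unfolding i_def using bdd[OF that(1)] that(2) by (rule cINF_lower)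
      have ge: "c \<le> i u" if "\<And>m. m \<in> C \<Longrightarrow> c \<le> m u" for c u
        unfolding i_def using False that by (intro cINF_greatest) auto
      have "sublinear_on V i"
        unfolding sublinear_on_def
      proof (intro conjI ballI allI impI)
        fix u w assume u: "u \<in> V" and w: "w \<in> V"
        \<comment> \<open>The chain property enters here: the smaller of \<open>m\<close> and
          \<open>n\<close> lies below both, and its own subadditivity gives the mixed
          estimate.\<close>
        have *: "i (u + w) \<le> m u + n w" if m: "m \<in> C" and n: "n \<in> C" for m n
        proof -
          obtain k where k: "k \<in> C" "k \<le> m" "k \<le> n" using chain[OF m n] m n by auto
          have "i (u + w) \<le> k (u + w)" using u w V k by (intro le) (auto intro: subspace_add)
          also have "\<dots> \<le> k u + k w" using k(1) CQ u w by (auto simp: Q_def intro: sublinear_on_add)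
          also have "\<dots> \<le> m u + n w" using k(2,3) by (auto simp: le_fun_def intro: add_mono)
          finally show ?thesis .
        qed
        have "i (u + w) - i w \<le> i u"
        proof (rule ge)
          fix m assume m: "m \<in> C"
          have "i (u + w) - m u \<le> i w" using *[OF m] by (intro ge) (simp add: algebra_simps)
          then show "i (u + w) - i w \<le> m u" by simp
        qed
        then show "i (u + w) \<le> i u + i w" by simp
      next
        fix c :: real and u assume c: "c > 0" and u: "u \<in> V"
        have "inverse c * i (c *\<^sub>R u) \<le> i u"
        proof (rule ge)
          fix m assume m: "m \<in> C"
          have "i (c *\<^sub>R u) \<le> m (c *\<^sub>R u)" using u V m by (intro le) (auto intro: subspace_scale)
          also have "\<dots> \<le> c * m u" using m CQ c u by (auto simp: Q_def intro: sublinear_on_scale_le)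
          finally show "inverse c * i (c *\<^sub>R u) \<le> m u" using c by (simp add: field_simps)
        qed
        then show "i (c *\<^sub>R u) \<le> c * i u" using c by (simp add: field_simps)
      qed
      moreover have "i u \<le> p u" if u: "u \<in> V" for u
      proof -
        obtain m where m: "m \<in> C" using False by auto
        have "m u \<le> p u" using CQ m u by (auto simp: Q_def)
        with le[OF u m] show ?thesis by simp
      qed
      ultimately have "(\<lambda>u. if u \<in> V then i u else 0) \<in> Q" by (rule restrict)
      moreover have "(\<lambda>u. if u \<in> V then i u else 0) \<le> m" if "m \<in> C" for m
        using le[OF _ that] CQ that by (auto simp: le_fun_def Q_def)
      ultimately show ?thesis by blast
    qed
  qed
  then obtain m where mQ: "m \<in> Q" and min: "\<And>a. a \<in> Q \<Longrightarrow> a \<le> m \<Longrightarrow> a = m" by blast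
  from mQ have m: "sublinear_on V m" and mp: "\<And>u. u \<in> V \<Longrightarrow> m u \<le> p u" and m0: "\<And>u. u \<notin> V \<Longrightarrow> m u = 0"
    by (auto simp: Q_def)
  have add: "m (u + x) = m u + m x" if u: "u \<in> V" and x: "x \<in> V" for u x
  proof -
    \<comment> \<open>\<open>m\<close> is lowered along the ray of multiples
      \<open>t *\<^sub>R x\<close> with \<open>t \<ge> 0\<close> and \<open>L t = t * m x\<close>.
      The case \<open>t = 0\<close> gives \<open>q \<le> m\<close>, so minimality forces
      \<open>q = m\<close> on \<open>V\<close>; the case \<open>t = 1\<close> is then the
      superadditivity missing from \<open>m\<close>.\<close>
    obtain q where q: "sublinear_on V q"
      and qle: "\<And>u t. u \<in> V \<Longrightarrow> t \<in> {0..} \<Longrightarrow> q u \<le> m (u + t *\<^sub>R x) - t * m x"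
      by (rule sublinear_on_lower[OF V m, where K = "{0::real..}" and A = "\<lambda>t. t *\<^sub>R x" and L = "\<lambda>t. t * m x"])
        (use V x in \<open>auto simp: scaleR_add_left algebra_simps sublinear_on_scale[OF V m] intro: subspace_scale\<close>)
    have qm: "q w \<le> m w" if "w \<in> V" for w using qle[OF that, of 0] by simp
    have "(\<lambda>u. if u \<in> V then q u else 0) \<in> Q" using qm mp by (intro restrict q) force
    moreover have "(\<lambda>u. if u \<in> V then q u else 0) \<le> m" using qm m0 by (auto simp: le_fun_def)
    ultimately have "(\<lambda>u. if u \<in> V then q u else 0) = m" by (rule min)
    from fun_cong[OF this, of u] have "m u = q u" using u by simp
    also have "\<dots> \<le> m (u + x) - m x" using qle[OF u, of 1] by simp
    finally show ?thesis using sublinear_on_add[OF m u x] by simp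
  qed
  have neg: "m (- u) = - m u" if u: "u \<in> V" for u
    using add[OF u subspace_neg[OF V u]] sublinear_on_0[OF V m] by simp
  have scale: "m (c *\<^sub>R u) = c * m u" if u: "u \<in> V" for c u
  proof (cases "c \<ge> 0")
    case True
    then show ?thesis using sublinear_on_scale[OF V m _ u] by blast
  next
    case False
    \<comment> \<open>A negative factor is split into the positive factor \<open>- c\<close> and a
      sign change, the latter handled by \<open>neg\<close>.\<close>
    then have "m ((- c) *\<^sub>R u) = (- c) * m u" by (intro sublinear_on_scale[OF V m _ u]) simp
    then show ?thesis using neg[OF subspace_scale[OF V u, of c]] by simp
  qed
  show ?thesis using mp add scale by (rule that)
qed

text \<open>A linear \<open>m\<close> below the lowered functional \<open>q\<close> does everything:
  \<open>k = 0\<close> in the bound on \<open>q\<close> gives \<open>m \<le> p\<close>,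
  \<open>u = - A k\<close> gives \<open>m (A k) \<ge> L k\<close>, and passing from \<open>k\<close>
  to \<open>- k\<close> turns this into equality.\<close>

lemma mazur_orlicz:
  fixes p :: "'v::real_vector \<Rightarrow> real" and A :: "'k::real_vector \<Rightarrow> 'v"
  assumes V: "subspace V" and p: "sublinear_on V p" and K: "subspace K"
    and AV: "\<And>k. k \<in> K \<Longrightarrow> A k \<in> V"
    and Aadd: "\<And>k l. k \<in> K \<Longrightarrow> l \<in> K \<Longrightarrow> A (k + l) = A k + A l"
    and Ascale: "\<And>c k. k \<in> K \<Longrightarrow> A (c *\<^sub>R k) = c *\<^sub>R A k"
    and Ladd: "\<And>k l. k \<in> K \<Longrightarrow> l \<in> K \<Longrightarrow> L (k + l) = L k + L l"
    and Lscale: "\<And>c k. k \<in> K \<Longrightarrow> L (c *\<^sub>R k) = c * L k"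
    and dom: "\<And>k. k \<in> K \<Longrightarrow> L k \<le> p (A k)"
  obtains m where "\<And>u. u \<in> V \<Longrightarrow> m u \<le> p u"
    "\<And>u w. u \<in> V \<Longrightarrow> w \<in> V \<Longrightarrow> m (u + w) = m u + m w"
    "\<And>c u. u \<in> V \<Longrightarrow> m (c *\<^sub>R u) = c * m u"
    "\<And>k. k \<in> K \<Longrightarrow> m (A k) = L k"
proof -
  obtain q where q: "sublinear_on V q"
    and qle: "\<And>u k. u \<in> V \<Longrightarrow> k \<in> K \<Longrightarrow> q u \<le> p (u + A k) - L k"
    by (rule sublinear_on_lower[OF V p, where K = K and A = A and L = L])
      (use K in \<open>auto simp: assms intro: subspace_0 subspace_add subspace_scale\<close>)
  obtain m where mq: "\<And>u. u \<in> V \<Longrightarrow> m u \<le> q u"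
    and add: "\<And>u w. u \<in> V \<Longrightarrow> w \<in> V \<Longrightarrow> m (u + w) = m u + m w"
    and scale: "\<And>c u. u \<in> V \<Longrightarrow> m (c *\<^sub>R u) = c * m u"
    using sublinear_on_dominates_linear[OF V q] by blast
  have K0: "0 \<in> K" using K by (rule subspace_0)
  have A0: "A 0 = 0" "L 0 = 0" using Ascale[OF K0, of 0] Lscale[OF K0, of 0] by auto
  have mp: "m u \<le> p u" if "u \<in> V" for u
    using mq[OF that] qle[OF that K0] A0 by simp
  have ge: "L k \<le> m (A k)" if k: "k \<in> K" for k
  proof -
    \<comment> \<open>At \<open>u = - A k\<close> the argument of \<open>p\<close> in the bound on
      \<open>q\<close> is 0, leaving only \<open>- L k\<close>.\<close>
    have "- A k \<in> V" using AV[OF k] V by (rule subspace_neg[rotated])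
    from mq[OF this] qle[OF this k] have "m ((-1) *\<^sub>R A k) \<le> - L k"
      using sublinear_on_0[OF V p] by simp
    then show ?thesis using scale[OF AV[OF k], of "-1"] by simp
  qed
  have "m (A k) = L k" if k: "k \<in> K" for k
  proof -
    \<comment> \<open>Since \<open>K\<close> is a subspace, the lower bound also holds at
      \<open>- k\<close>, where it reads as an upper bound at \<open>k\<close>.\<close>
    have "L ((-1) *\<^sub>R k) \<le> m (A ((-1) *\<^sub>R k))"
      using k K by (intro ge) (rule subspace_scale)
    then have "m (A k) \<le> L k"
      unfolding Ascale[OF k] Lscale[OF k] scale[OF AV[OF k]] by simp
    with ge[OF k] show ?thesis by simp
  qed
  then show ?thesis using mp add scale by (intro that[of m])
qed

subsection \<open>Bounded measurable functions\<close>

lemma bounded_measurableI: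
  assumes "f \<in> borel_measurable M" "\<And>x. x \<in> space M \<Longrightarrow> \<bar>f x\<bar> \<le> B"
  shows "bounded_measurable M f"
  using assms by (auto simp: bounded_measurable_def bounded_iff)

lemma bounded_measurableE:
  assumes "bounded_measurable M f"
  obtains B where "f \<in> borel_measurable M" "\<And>x. x \<in> space M \<Longrightarrow> \<bar>f x\<bar> \<le> B" "B \<ge> 0"
proof -
  from assms obtain B where B: "\<And>x. x \<in> space M \<Longrightarrow> \<bar>f x\<bar> \<le> B" and f: "f \<in> borel_measurable M"
    by (auto simp: bounded_measurable_def bounded_iff)
  \<comment> \<open>On an empty space a negative \<open>B\<close> is also a bound, hence the maximum
    with 0.\<close>
  have "\<bar>f x\<bar> \<le> max B 0" if "x \<in> space M" for x using B[OF that] by simp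
  with f show ?thesis by (intro that[of "max B 0"]) auto
qed

lemma bounded_measurable_add:
  assumes "bounded_measurable M f" "bounded_measurable M g"
  shows "bounded_measurable M (\<lambda>x. f x + g x)"
proof -
  from assms(1) obtain B where B: "f \<in> borel_measurable M" "\<And>x. x \<in> space M \<Longrightarrow> \<bar>f x\<bar> \<le> B"
    by (elim bounded_measurableE) blast
  from assms(2) obtain C where C: "g \<in> borel_measurable M" "\<And>x. x \<in> space M \<Longrightarrow> \<bar>g x\<bar> \<le> C"
    by (elim bounded_measurableE) blast
  have "\<bar>f x + g x\<bar> \<le> B + C" if "x \<in> space M" for x
    using B(2)[OF that] C(2)[OF that] by linarith
  with B(1) C(1) show ?thesis by (intro bounded_measurableI) auto
qed

lemma bounded_measurable_cmult:
  assumes "bounded_measurable M f"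
  shows "bounded_measurable M (\<lambda>x. c * f x)"
proof -
  from assms obtain B where B: "f \<in> borel_measurable M" "\<And>x. x \<in> space M \<Longrightarrow> \<bar>f x\<bar> \<le> B"
    by (elim bounded_measurableE) blast
  have "\<bar>c * f x\<bar> \<le> \<bar>c\<bar> * B" if "x \<in> space M" for x
    using B(2)[OF that] by (simp add: abs_mult mult_left_mono)
  with B(1) show ?thesis by (intro bounded_measurableI) auto
qed

lemma bounded_measurable_diff:
  assumes "bounded_measurable M f" "bounded_measurable M g"
  shows "bounded_measurable M (\<lambda>x. f x - g x)"
  using bounded_measurable_add[OF assms(1) bounded_measurable_cmult[OF assms(2), of "-1"]] by simp

lemma bounded_measurable_indicator:
  assumes "A \<in> sets M"
  shows "bounded_measurable M (indicator A)"
  using assms by (intro bounded_measurableI[of _ _ 1]) (auto simp: indicator_def)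

lemma bounded_measurable_sum:
  assumes "\<And>i. i \<in> I \<Longrightarrow> bounded_measurable M (f i)"
  shows "bounded_measurable M (\<lambda>x. \<Sum>i\<in>I. f i x)"
  using assms
proof (induction I rule: infinite_finite_induct)
  case (insert i I)
  then show ?case by (auto intro: bounded_measurable_add)
qed (auto intro: bounded_measurableI[of _ _ 0])

lemma bounded_measurable_compose:
  assumes f: "bounded_measurable M f" and g: "g \<in> N \<rightarrow>\<^sub>M M"
  shows "bounded_measurable N (\<lambda>x. f (g x))"
proof -
  from f obtain B where B: "f \<in> borel_measurable M" "\<And>x. x \<in> space M \<Longrightarrow> \<bar>f x\<bar> \<le> B"
    by (elim bounded_measurableE) blast
  show ?thesis
    using B g measurable_space[OF g] by (intro bounded_measurableI[of _ _ B]) (auto intro: measurable_compose[OF g])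
qed

lemma bounded_measurable_pos_part:
  assumes "bounded_measurable M f"
  shows "bounded_measurable M (\<lambda>x. pos_part (f x))"
proof -
  from assms obtain B where B: "f \<in> borel_measurable M" "\<And>x. x \<in> space M \<Longrightarrow> \<bar>f x\<bar> \<le> B"
    by (elim bounded_measurableE) blast
  have "\<bar>pos_part (f x)\<bar> \<le> B" if "x \<in> space M" for x
    using B(2)[OF that] by (auto simp: pos_part_def)
  with B(1) show ?thesis
    by (intro bounded_measurableI) (auto simp: pos_part_def)
qed

section \<open>Integration of bounded functions against finite measures\<close>

lemma finite_measure_on_space: "finite_measure_on M \<mu> \<Longrightarrow> space \<mu> = space M"
  by (auto simp: finite_measure_on_def dest: sets_eq_imp_space_eq)

lemma integrable_bounded_measurable:
  assumes "finite_measure_on M \<mu>" "bounded_measurable M f"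
  shows "integrable \<mu> f"
proof -
  from assms(2) obtain B where B: "f \<in> borel_measurable M" "\<And>x. x \<in> space M \<Longrightarrow> \<bar>f x\<bar> \<le> B"
    by (elim bounded_measurableE) blast
  interpret finite_measure \<mu> using assms(1) by (simp add: finite_measure_on_def)
  have "f \<in> borel_measurable \<mu>"
    using B(1) assms(1) by (simp add: finite_measure_on_def cong: measurable_cong_sets)
  then show ?thesis
    using B(2) finite_measure_on_space[OF assms(1)] by (intro integrable_const_bound[of _ B]) auto
qed

lemma integral_le_const:
  assumes \<mu>: "finite_measure_on M \<mu>" and f: "bounded_measurable M f"
    and le: "\<And>x. x \<in> space M \<Longrightarrow> f x \<le> e"
  shows "(\<integral>x. f x \<partial>\<mu>) \<le> measure \<mu> (space M) * e"
proof -
  interpret finite_measure \<mu> using \<mu> by (simp add: finite_measure_on_def)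
  have "(\<integral>x. f x \<partial>\<mu>) \<le> (\<integral>x. e \<partial>\<mu>)"
    using integrable_bounded_measurable[OF \<mu> f] le finite_measure_on_space[OF \<mu>]
    by (intro integral_mono) auto
  then show ?thesis using finite_measure_on_space[OF \<mu>] by simp
qed

lemma abs_integral_le_const:
  assumes \<mu>: "finite_measure_on M \<mu>" and f: "bounded_measurable M f"
    and le: "\<And>x. x \<in> space M \<Longrightarrow> \<bar>f x\<bar> \<le> e"
  shows "\<bar>\<integral>x. f x \<partial>\<mu>\<bar> \<le> measure \<mu> (space M) * e"
proof -
  have "f x \<le> e" "(-1) * f x \<le> e" if "x \<in> space M" for x using le[OF that] by auto
  from integral_le_const[OF \<mu> f this(1)] integral_le_const[OF \<mu> bounded_measurable_cmult[OF f, of "-1"] this(2)]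
  show ?thesis by simp
qed

text \<open>For nonnegative integrands, monotonicity in the measure is available for
  \<open>nn_integral\<close>; integrability under both measures carries it over to the Bochner
  integral.\<close>

lemma integral_mono_setwise_le:
  assumes \<phi>: "finite_measure_on M \<phi>" and \<psi>: "finite_measure_on M \<psi>" and le: "setwise_le \<phi> \<psi>"
    and f: "bounded_measurable M f" and nonneg: "\<And>x. 0 \<le> f x"
  shows "(\<integral>x. f x \<partial>\<phi>) \<le> (\<integral>x. f x \<partial>\<psi>)"
proof -
  have sets: "sets \<phi> = sets \<psi>" using \<phi> \<psi> by (simp add: finite_measure_on_def)
  then have "\<phi> \<le> \<psi>" using le by (auto simp: setwise_le_def le_measure)
  then have "(\<integral>\<^sup>+x. ennreal (f x) \<partial>\<phi>) \<le> (\<integral>\<^sup>+x. ennreal (f x) \<partial>\<psi>)"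
    by (rule nn_integral_mono_measure[OF sets])
  then show ?thesis
    using integrable_bounded_measurable[OF \<phi> f] integrable_bounded_measurable[OF \<psi> f] nonneg
    by (simp add: nn_integral_eq_integral Bochner_Integration.integral_nonneg)
qed

subsection \<open>Functionals on bounded measurable functions\<close>

text \<open>Simple functions are uniformly dense in the bounded measurable ones, and
  \<open>D\<close> is continuous for the sup norm. Applied to a difference of two functionals, this
  extends an identity from sets to functions.\<close>

lemma bounded_functional_eq_0:
  fixes D :: "('a \<Rightarrow> real) \<Rightarrow> real"
  assumes add: "\<And>u w. bounded_measurable M u \<Longrightarrow> bounded_measurable M w \<Longrightarrow> D (\<lambda>x. u x + w x) = D u + D w"
    and cmult: "\<And>c u. bounded_measurable M u \<Longrightarrow> D (\<lambda>x. c * u x) = c * D u"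
    and ind: "\<And>A. A \<in> sets M \<Longrightarrow> D (indicator A) = 0"
    and bound: "\<And>u e. bounded_measurable M u \<Longrightarrow> (\<And>x. x \<in> space M \<Longrightarrow> \<bar>u x\<bar> \<le> e) \<Longrightarrow> e \<ge> 0 \<Longrightarrow> \<bar>D u\<bar> \<le> C * e"
    and u: "bounded_measurable M u"
  shows "D u = 0"
proof -
  have D0: "D (\<lambda>x. 0) = 0" using cmult[OF bounded_measurable_indicator[OF sets.empty_sets], of 0] by simp
  have simple: "D (\<lambda>x. \<Sum>i\<in>I. c i * indicator (S i) x) = 0"
    if "finite I" "\<And>i. i \<in> I \<Longrightarrow> S i \<in> sets M" for I :: "int set" and c S
    using that
  proof (induction I)
    case (insert i I)
    then have "D (\<lambda>x. c i * indicator (S i) x + (\<Sum>i\<in>I. c i * indicator (S i) x)) =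
        D (\<lambda>x. c i * indicator (S i) x) + D (\<lambda>x. \<Sum>i\<in>I. c i * indicator (S i) x)"
      by (intro add bounded_measurable_sum bounded_measurable_cmult bounded_measurable_indicator) auto
    moreover have "D (\<lambda>x. c i * indicator (S i) x) = 0"
      using insert.prems by (simp add: cmult bounded_measurable_indicator ind)
    moreover have "D (\<lambda>x. \<Sum>i\<in>I. c i * indicator (S i) x) = 0"
      using insert by blast
    ultimately show ?case by (simp only: sum.insert[OF insert.hyps] add_0)
  qed (use D0 in simp)
  from u obtain B where meas [measurable]: "u \<in> borel_measurable M"
    and B: "\<And>x. x \<in> space M \<Longrightarrow> \<bar>u x\<bar> \<le> B" and "B \<ge> 0"
    by (elim bounded_measurableE) blast
  have approx: "\<bar>D u\<bar> \<le> C * (1 / real n)" if n: "n > 0" for n :: nat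
  proof -
    \<comment> \<open>The approximant \<open>s\<close> rounds \<open>u\<close> down to a multiple of
      \<open>1 / n\<close>. Since \<open>\<bar>u\<bar> \<le> B\<close>, the finite interval
      \<open>I\<close> contains every value of the floor of \<open>n * u\<close>, so
      \<open>s\<close> is a finite sum of indicators.\<close>
    define I where "I = {- \<lceil>real n * B\<rceil> - 1..\<lceil>real n * B\<rceil> + 1}"
    define S where "S = (\<lambda>k. {x \<in> space M. \<lfloor>real n * u x\<rfloor> = k})"
    define s where "s = (\<lambda>x. \<Sum>k\<in>I. (of_int k / real n) * indicator (S k) x)"
    have S: "S k \<in> sets M" for k unfolding S_def by measurable
    have sval: "s x = of_int \<lfloor>real n * u x\<rfloor> / real n" if x: "x \<in> space M" for x
    proof -
      have "\<bar>real n * u x\<bar> \<le> real n * B"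
        using B[OF x] by (simp add: abs_mult mult_left_mono)
      then have "\<lfloor>real n * u x\<rfloor> \<in> I" unfolding I_def by simp linarith
      moreover have "s x = (\<Sum>k\<in>I. if \<lfloor>real n * u x\<rfloor> = k then of_int k / real n else 0)"
        unfolding s_def using x by (intro sum.cong) (auto simp: S_def indicator_def)
      ultimately show ?thesis by (simp add: I_def)
    qed
    have bs: "bounded_measurable M s"
      unfolding s_def using S
      by (intro bounded_measurable_sum bounded_measurable_cmult bounded_measurable_indicator)
    have "D s = 0" unfolding s_def using S by (intro simple) (auto simp: I_def)
    \<comment> \<open>Additivity removes the simple part, leaving \<open>D\<close> of an error that
      is at most \<open>1 / n\<close> everywhere.\<close>
    moreover have "D (\<lambda>x. (u x - s x) + s x) = D (\<lambda>x. u x - s x) + D s"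
      by (intro add bounded_measurable_diff u bs)
    ultimately have "D u = D (\<lambda>x. u x - s x)" by simp
    also have "\<bar>\<dots>\<bar> \<le> C * (1 / real n)"
    proof (rule bound)
      fix x assume x: "x \<in> space M"
      have "u x - s x = (real n * u x - of_int \<lfloor>real n * u x\<rfloor>) / real n"
        using n by (simp add: sval[OF x] field_simps)
      moreover have "0 \<le> real n * u x - of_int \<lfloor>real n * u x\<rfloor>" "real n * u x - of_int \<lfloor>real n * u x\<rfloor> \<le> 1"
        by linarith+
      ultimately show "\<bar>u x - s x\<bar> \<le> 1 / real n"
        using n by (simp add: divide_right_mono)
    qed (auto intro: bounded_measurable_diff u bs)
    finally show ?thesis .
  qed
  have "(\<lambda>n. C * (1 / real n)) \<longlonglongrightarrow> C * 0"
    by (intro tendsto_mult tendsto_const lim_1_over_n)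
  moreover have "\<forall>\<^sub>F n in sequentially. \<bar>D u\<bar> \<le> C * (1 / real n)"
    using approx by (auto intro: eventually_sequentiallyI[of 1])
  ultimately have "\<bar>D u\<bar> \<le> C * 0"
    by (intro tendsto_lowerbound[of _ _ sequentially]) auto
  then show ?thesis by simp
qed

text \<open>A Riesz-type representation in which domination by \<open>\<psi>\<close> replaces a
  continuity assumption: sets decreasing to the empty set have \<open>\<psi>\<close>-measure tending
  to 0, which forces countable additivity.\<close>

lemma dominated_functional_measure:
  fixes m :: "('a \<Rightarrow> real) \<Rightarrow> real"
  assumes \<psi>: "finite_measure_on M \<psi>"
    and add: "\<And>u w. bounded_measurable M u \<Longrightarrow> bounded_measurable M w \<Longrightarrow> m (\<lambda>x. u x + w x) = m u + m w"
    and cmult: "\<And>c u. bounded_measurable M u \<Longrightarrow> m (\<lambda>x. c * u x) = c * m u"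
    and le: "\<And>u. bounded_measurable M u \<Longrightarrow> m u \<le> (\<integral>x. pos_part (u x) \<partial>\<psi>)"
  obtains \<phi> where "finite_measure_on M \<phi>" "setwise_le \<phi> \<psi>"
    "\<And>u. bounded_measurable M u \<Longrightarrow> (\<integral>x. u x \<partial>\<phi>) = m u"
proof -
  interpret \<psi>: finite_measure \<psi> using \<psi> by (simp add: finite_measure_on_def)
  have sets: "sets \<psi> = sets M" using \<psi> by (simp add: finite_measure_on_def)
  have nonneg: "0 \<le> m (indicator A)" if "A \<in> sets M" for A
  proof -
    have bA: "bounded_measurable M (indicator A)" using that by (rule bounded_measurable_indicator)
    \<comment> \<open>Domination is tested at the negative of the indicator, whose positive part is
      0.\<close>
    have "- m (indicator A) = m (\<lambda>x. (-1) * indicator A x)" using cmult[OF bA, of "-1"] by simp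
    also have "\<dots> \<le> (\<integral>x. pos_part ((-1) * indicator A x) \<partial>\<psi>)"
      using bA by (intro le bounded_measurable_cmult)
    also have "\<dots> = 0" by (simp add: pos_part_def indicator_def)
    finally show ?thesis by simp
  qed
  have leA: "m (indicator A) \<le> measure \<psi> A" if A: "A \<in> sets M" for A
  proof -
    have "m (indicator A) \<le> (\<integral>x. pos_part (indicator A x) \<partial>\<psi>)"
      using A by (intro le bounded_measurable_indicator)
    also have "(\<lambda>x. pos_part (indicator A x)) = (indicator A :: 'a \<Rightarrow> real)"
      by (auto simp: pos_part_def indicator_def)
    also have "integral\<^sup>L \<psi> (indicator A) = measure \<psi> A"
      using A sets by (simp add: Int_absorb2 sets.sets_into_space)
    finally show ?thesis .
  qed
  define F where "F = (\<lambda>A. ennreal (m (indicator A)))"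
  have F_le: "F A \<le> emeasure \<psi> A" if "A \<in> sets M" for A
    using leA[OF that] by (simp add: F_def \<psi>.emeasure_eq_measure ennreal_leI)
  \<comment> \<open>For the empty set \<open>leA\<close> bounds the value above by 0, and
    \<open>ennreal\<close> sends nonpositive reals to 0.\<close>
  have F_pos: "positive (sets M) F"
    using leA[of "{}"] by (auto simp: positive_def F_def ennreal_neg)
  have F_add: "additive (sets M) F"
    unfolding additive_def
  proof (intro ballI impI)
    fix A B assume AB: "A \<in> sets M" "B \<in> sets M" "A \<inter> B = {}"
    have "indicator (A \<union> B) = (\<lambda>x. indicator A x + indicator B x :: real)"
      using AB(3) by (auto simp: indicator_def fun_eq_iff)
    then show "F (A \<union> B) = F A + F B"
      using AB nonneg add[OF bounded_measurable_indicator[OF AB(1)] bounded_measurable_indicator[OF AB(2)]]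
      by (simp add: F_def)
  qed
  \<comment> \<open>A finite-valued additive set function is countably additive once it is
    continuous at the empty set; \<open>F\<close> is squeezed between 0 and
    \<open>\<psi>\<close>.\<close>
  have F_ca: "countably_additive (sets M) F"
  proof (rule sets.empty_continuous_imp_countably_additive[OF F_pos F_add])
    show "\<forall>A\<in>sets M. F A \<noteq> \<infinity>" by (simp add: F_def)
  next
    fix A :: "nat \<Rightarrow> 'a set"
    assume A: "range A \<subseteq> sets M" "decseq A" "(\<Inter>i. A i) = {}"
    have lim: "(\<lambda>i. emeasure \<psi> (A i)) \<longlonglongrightarrow> 0"
      using Lim_emeasure_decseq[of A \<psi>] A sets by simp
    have F_le': "F (A i) \<le> emeasure \<psi> (A i)" for i using A(1) by (intro F_le) auto
    show "(\<lambda>i. F (A i)) \<longlonglongrightarrow> 0"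
    proof (rule tendsto_sandwich)
      show "\<forall>\<^sub>F i in sequentially. 0 \<le> F (A i)" by simp
      show "\<forall>\<^sub>F i in sequentially. F (A i) \<le> emeasure \<psi> (A i)" using F_le' by simp
    qed (rule tendsto_const, fact lim)
  qed
  define \<phi> where "\<phi> = measure_of (space M) (sets M) F"
  have sets_\<phi>: "sets \<phi> = sets M" by (simp add: \<phi>_def)
  have em: "emeasure \<phi> A = F A" if "A \<in> sets M" for A
    using F_pos F_ca that by (auto simp: \<phi>_def intro!: emeasure_measure_of_sigma sets.sigma_algebra_axioms)
  have fin: "finite_measure_on M \<phi>"
    unfolding finite_measure_on_def
    using sets_\<phi> em[of "space \<phi>"] sets_eq_imp_space_eq[OF sets_\<phi>] by (auto intro!: finite_measureI simp: F_def)
  have int_\<phi>: "(\<integral>x. u x \<partial>\<phi>) = m u" if u: "bounded_measurable M u" for u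
  proof -
    define D :: "('a \<Rightarrow> real) \<Rightarrow> real" where "D = (\<lambda>u. (\<integral>x. u x \<partial>\<phi>) - m u)"
    have m_le: "m u \<le> measure \<psi> (space M) * e"
      if "bounded_measurable M u" "\<And>x. x \<in> space M \<Longrightarrow> \<bar>u x\<bar> \<le> e" "e \<ge> 0" for u e
      using le[OF that(1)] integral_le_const[OF \<psi> bounded_measurable_pos_part[OF that(1)], of e] that(2,3)
      by (force simp: pos_part_def)
    have "D u = 0"
    \<comment> \<open>For \<open>\<bar>u\<bar> \<le> e\<close>, the integral contributes at most
      \<open>\<phi>\<close>'s total mass times \<open>e\<close> and \<open>m\<close> at most
      \<open>\<psi>\<close>'s total mass times \<open>e\<close>, whence the constant
      \<open>C\<close>.\<close>
    proof (rule bounded_functional_eq_0[OF _ _ _ _ u, where C = "measure \<phi> (space M) + measure \<psi> (space M)"])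
      fix u w :: "'a \<Rightarrow> real" and c :: real
      assume u: "bounded_measurable M u"
      show "D (\<lambda>x. c * u x) = c * D u" using cmult[OF u] by (simp add: D_def algebra_simps)
      assume w: "bounded_measurable M w"
      show "D (\<lambda>x. u x + w x) = D u + D w"
        using add[OF u w] integrable_bounded_measurable[OF fin u] integrable_bounded_measurable[OF fin w]
        by (simp add: D_def)
    next
      fix A assume A: "A \<in> sets M"
      then have "measure \<phi> A = m (indicator A)"
        using em[OF A] nonneg by (simp add: measure_def F_def)
      then show "D (indicator A) = 0"
        using A sets_\<phi> by (simp add: D_def Int_absorb2 sets.sets_into_space)
    next
      fix u and e :: real
      assume u: "bounded_measurable M u" and e: "\<And>x. x \<in> space M \<Longrightarrow> \<bar>u x\<bar> \<le> e" "e \<ge> 0"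
      have "m u \<le> measure \<psi> (space M) * e" using u e by (rule m_le)
      \<comment> \<open>Applying the upper bound to the negative of \<open>u\<close> gives the lower
        bound on \<open>m u\<close>.\<close>
      moreover have "m (\<lambda>x. (-1) * u x) \<le> measure \<psi> (space M) * e"
        using e by (intro m_le bounded_measurable_cmult u) auto
      ultimately show "\<bar>D u\<bar> \<le> (measure \<phi> (space M) + measure \<psi> (space M)) * e"
        using abs_integral_le_const[OF fin u e(1)] cmult[OF u, of "-1"]
        by (simp add: D_def algebra_simps)
    qed
    then show ?thesis by (simp add: D_def)
  qed
  have "setwise_le \<phi> \<psi>" using F_le em sets by (simp add: setwise_le_def)
  with fin int_\<phi> show ?thesis by (intro that[of \<phi>])
qed

section \<open>The flow condition tested on functions\<close>

text \<open>On indicators this is the defining identity of a flow with both sides negated;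
  \<open>bounded_functional_eq_0\<close> extends it to bounded measurable functions.\<close>

lemma integral_flow:
  assumes \<sigma>: "finite_measure_on M \<sigma>" and \<tau>: "finite_measure_on M \<tau>"
    and flow: "flow M \<sigma> \<tau> \<phi>" and f: "bounded_measurable M f"
  shows "(\<integral>z. f (snd z) - f (fst z) \<partial>\<phi>) = (\<integral>x. f x \<partial>\<tau>) - (\<integral>x. f x \<partial>\<sigma>)"
proof -
  have \<phi>: "finite_measure_on (M \<Otimes>\<^sub>M M) \<phi>" using flow by (simp add: flow_def)
  then have sets: "sets \<phi> = sets (M \<Otimes>\<^sub>M M)" by (simp add: finite_measure_on_def)
  interpret finite_measure \<phi> using \<phi> by (simp add: finite_measure_on_def)
  note [simp] = finite_measure_on_space[OF \<phi>] space_pair_measure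
  have comp: "bounded_measurable (M \<Otimes>\<^sub>M M) (\<lambda>z. u (fst z))" "bounded_measurable (M \<Otimes>\<^sub>M M) (\<lambda>z. u (snd z))"
    if "bounded_measurable M u" for u
    using that by (auto intro: bounded_measurable_compose)
  note int = integrable_bounded_measurable[OF \<phi> comp(1)] integrable_bounded_measurable[OF \<phi> comp(2)]
    integrable_bounded_measurable[OF \<sigma>] integrable_bounded_measurable[OF \<tau>]
  define D :: "('a \<Rightarrow> real) \<Rightarrow> real" where "D = (\<lambda>u. (\<integral>z. u (snd z) \<partial>\<phi>) - (\<integral>z. u (fst z) \<partial>\<phi>) - (\<integral>x. u x \<partial>\<tau>) + (\<integral>x. u x \<partial>\<sigma>))"
  have "D f = 0"
  \<comment> \<open>The factor 2 in \<open>C\<close> accounts for the two marginals of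
    \<open>\<phi>\<close>, each of the same total mass.\<close>
  proof (rule bounded_functional_eq_0[OF _ _ _ _ f, where C = "2 * measure \<phi> (space M \<times> space M) + measure \<tau> (space M) + measure \<sigma> (space M)"])
    fix u w :: "'a \<Rightarrow> real" and c :: real
    show "D (\<lambda>x. c * u x) = c * D u" by (simp add: D_def algebra_simps)
    assume "bounded_measurable M u" "bounded_measurable M w"
    then show "D (\<lambda>x. u x + w x) = D u + D w" by (simp add: D_def int)
  next
    fix A assume A: "A \<in> sets M"
    \<comment> \<open>The two integrands agree only on the space of \<open>\<phi>\<close>, where the
      other coordinate lies in \<open>space M\<close>; this suffices for the integrals.\<close>
    have "(\<integral>z. indicator A (fst z) \<partial>\<phi>) = (\<integral>z. indicat_real (A \<times> space M) z \<partial>\<phi>)"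
      by (intro Bochner_Integration.integral_cong) (auto simp: indicator_def)
    moreover have "(\<integral>z. indicator A (snd z) \<partial>\<phi>) = (\<integral>z. indicat_real (space M \<times> A) z \<partial>\<phi>)"
      by (intro Bochner_Integration.integral_cong) (auto simp: indicator_def)
    moreover have "A \<subseteq> space M" using A by (rule sets.sets_into_space)
    ultimately show "D (indicator A) = 0"
      using flow[unfolded flow_def, THEN conjunct2, rule_format, OF A]
        finite_measure_on_space[OF \<sigma>] finite_measure_on_space[OF \<tau>]
      by (simp add: D_def Int_absorb2 Sigma_mono)
  next
    fix u and e :: real
    assume u: "bounded_measurable M u" and e: "\<And>x. x \<in> space M \<Longrightarrow> \<bar>u x\<bar> \<le> e" "e \<ge> 0"
    have "\<bar>\<integral>z. u (fst z) \<partial>\<phi>\<bar> \<le> measure \<phi> (space (M \<Otimes>\<^sub>M M)) * e"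
      using e(1) by (intro abs_integral_le_const[OF \<phi> comp(1)[OF u]]) auto
    moreover have "\<bar>\<integral>z. u (snd z) \<partial>\<phi>\<bar> \<le> measure \<phi> (space (M \<Otimes>\<^sub>M M)) * e"
      using e(1) by (intro abs_integral_le_const[OF \<phi> comp(2)[OF u]]) auto
    ultimately show "\<bar>D u\<bar> \<le> (2 * measure \<phi> (space M \<times> space M) + measure \<tau> (space M) + measure \<sigma> (space M)) * e"
      using abs_integral_le_const[OF \<tau> u e(1)] abs_integral_le_const[OF \<sigma> u e(1)]
      by (simp add: D_def algebra_simps)
  qed
  then show ?thesis
    unfolding D_def Bochner_Integration.integral_diff[OF int(2)[OF f] int(1)[OF f]] by simp
qed

section \<open>Functions as a real vector space\<close>

text \<open>Pointwise scaling joins the pointwise addition on functions, so that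
  \<open>subspace\<close> and \<open>mazur_orlicz\<close> apply to the bounded measurable
  functions.\<close>

instantiation "fun" :: (type, real_vector) real_vector
begin

definition scaleR_fun :: "real \<Rightarrow> ('a \<Rightarrow> 'b) \<Rightarrow> 'a \<Rightarrow> 'b" where
  "c *\<^sub>R f = (\<lambda>x. c *\<^sub>R f x)"

instance
  by standard (simp_all add: scaleR_fun_def fun_eq_iff scaleR_add_left scaleR_add_right)

end

lemma scaleR_fun_real: "c *\<^sub>R f = (\<lambda>x. c * f x :: real)"
  by (simp add: scaleR_fun_def)

lemma subspace_bounded_measurable: "subspace {f. bounded_measurable M f}"
  by (auto simp: subspace_def zero_fun_def plus_fun_def scaleR_fun_real
      intro: bounded_measurableI[of _ _ 0] bounded_measurable_add bounded_measurable_cmult)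

lemma sublinear_on_integral_pos_part:
  assumes \<psi>: "finite_measure_on M \<psi>"
  shows "sublinear_on {f. bounded_measurable M f} (\<lambda>u. \<integral>x. pos_part (u x) \<partial>\<psi>)"
  unfolding sublinear_on_def
proof (intro conjI ballI allI impI)
  fix u w assume "u \<in> {f. bounded_measurable M f}" "w \<in> {f. bounded_measurable M f}"
  then have u: "bounded_measurable M u" and w: "bounded_measurable M w" by auto
  note int = integrable_bounded_measurable[OF \<psi> bounded_measurable_pos_part]
  have "(\<integral>x. pos_part ((u + w) x) \<partial>\<psi>) \<le> (\<integral>x. pos_part (u x) + pos_part (w x) \<partial>\<psi>)"
    using int[OF u] int[OF w] int[OF bounded_measurable_add[OF u w]]
    by (intro integral_mono) (auto simp: pos_part_def)
  then show "(\<integral>x. pos_part ((u + w) x) \<partial>\<psi>) \<le> (\<integral>x. pos_part (u x) \<partial>\<psi>) + (\<integral>x. pos_part (w x) \<partial>\<psi>)"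
    using int[OF u] int[OF w] by simp
next
  fix c :: real and u :: "'a \<Rightarrow> real" assume c: "c > 0"
  have "pos_part ((c *\<^sub>R u) x) = c * pos_part (u x)" for x
    using c by (auto simp: pos_part_def scaleR_fun_real max_def zero_le_mult_iff mult_le_0_iff)
  then show "(\<integral>x. pos_part ((c *\<^sub>R u) x) \<partial>\<psi>) \<le> c * (\<integral>x. pos_part (u x) \<partial>\<psi>)" by simp
qed

section \<open>The criterion for flows below \<open>\<psi>\<close> with prescribed
  \<open>v\<close>-value\<close>

theorem theorem4p12:
  fixes M \<sigma> \<tau> :: "'a measure"
    and \<psi> :: "('a \<times> 'a) measure"
    and v :: "'a \<times> 'a \<Rightarrow> real"
  assumes "standard_borel_space M"
    and "bounded_measurable (M \<Otimes>\<^sub>M M) v"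
    and "\<And>x y. x \<in> space M \<Longrightarrow> y \<in> space M \<Longrightarrow> 0 \<le> v (x, y)"
    and "finite_measure_on (M \<Otimes>\<^sub>M M) \<psi>"
    and "finite_measure_on M \<sigma>"
    and "finite_measure_on M \<tau>"
    and "measure \<sigma> (space M) = measure \<tau> (space M)"
  shows "(\<exists>\<phi>. flow M \<sigma> \<tau> \<phi> \<and> setwise_le \<phi> \<psi> \<and> (\<integral>p. v p \<partial>\<phi>) = 1) \<longleftrightarrow>
    (\<forall>f b. bounded_measurable M f \<and> b \<in> {-1, 0, 1} \<longrightarrow>
       (\<integral>(x, y). pos_part (f y - f x + b * v (x, y)) \<partial>\<psi>)
         \<ge> (\<integral>x. f x \<partial>\<tau>) - (\<integral>x. f x \<partial>\<sigma>) + b)"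
proof -
  note v = assms(2) and \<psi> = assms(4) and \<sigma> = assms(5) and \<tau> = assms(6)
  \<comment> \<open>With these abbreviations the integral condition reads
    \<open>L (f, b) \<le> p (A (f, b))\<close>, with \<open>A\<close> and \<open>L\<close> linear in
    the pair.\<close>
  define A where "A = (\<lambda>(f, b) z. f (snd z) - f (fst z) + b * v z)"
  define L :: "('a \<Rightarrow> real) \<times> real \<Rightarrow> real"
    where "L = (\<lambda>(f, b). (\<integral>x. f x \<partial>\<tau>) - (\<integral>x. f x \<partial>\<sigma>) + b)"
  define p where "p = (\<lambda>u. \<integral>z. pos_part (u z) \<partial>\<psi>)"
  have bdiff: "bounded_measurable (M \<Otimes>\<^sub>M M) (\<lambda>z. f (snd z) - f (fst z))" if "bounded_measurable M f" for f
    using that by (intro bounded_measurable_diff) (auto intro: bounded_measurable_compose)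
  have bA: "bounded_measurable (M \<Otimes>\<^sub>M M) (A (f, b))" if "bounded_measurable M f" for f b
    unfolding A_def using bounded_measurable_add[OF bdiff[OF that] bounded_measurable_cmult[OF v, of b]] by simp
  have int_A: "(\<integral>(x, y). pos_part (f y - f x + b * v (x, y)) \<partial>\<psi>) = p (A (f, b))" for f b
    by (simp add: p_def A_def case_prod_unfold)
  show ?thesis
    unfolding int_A
  proof (intro iffI allI impI)
    fix f and b :: real
    assume "\<exists>\<phi>. flow M \<sigma> \<tau> \<phi> \<and> setwise_le \<phi> \<psi> \<and> (\<integral>p. v p \<partial>\<phi>) = 1"
    then obtain \<phi> where flow: "flow M \<sigma> \<tau> \<phi>" and le: "setwise_le \<phi> \<psi>" and v1: "(\<integral>p. v p \<partial>\<phi>) = 1" by blast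
    assume "bounded_measurable M f \<and> b \<in> {-1, 0, 1}"
    then have f: "bounded_measurable M f" by simp
    have \<phi>: "finite_measure_on (M \<Otimes>\<^sub>M M) \<phi>" using flow by (simp add: flow_def)
    note int = integrable_bounded_measurable[OF \<phi>]
    \<comment> \<open>For a flow with \<open>v\<close>-integral 1, the right-hand side of the
      criterion is exactly the \<open>\<phi>\<close>-integral of \<open>A (f, b)\<close>. It grows
      on passing to the positive part and then from \<open>\<phi>\<close> to
      \<open>\<psi>\<close>.\<close>
    have "(\<integral>x. f x \<partial>\<tau>) - (\<integral>x. f x \<partial>\<sigma>) + b = (\<integral>z. A (f, b) z \<partial>\<phi>)"
      using int[OF bdiff[OF f]] int[OF v] integral_flow[OF \<sigma> \<tau> flow f] v1
      by (simp add: A_def)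
    also have "\<dots> \<le> (\<integral>z. pos_part (A (f, b) z) \<partial>\<phi>)"
      using bA[OF f] by (intro integral_mono int bounded_measurable_pos_part) (auto simp: pos_part_def)
    also have "\<dots> \<le> p (A (f, b))"
      unfolding p_def using bA[OF f]
      by (intro integral_mono_setwise_le[OF \<phi> \<psi> le] bounded_measurable_pos_part) (auto simp: pos_part_def)
    finally show "(\<integral>x. f x \<partial>\<tau>) - (\<integral>x. f x \<partial>\<sigma>) + b \<le> p (A (f, b))" .
  next
    assume R: "\<forall>f b. bounded_measurable M f \<and> b \<in> {-1, 0, 1} \<longrightarrow>
      (\<integral>x. f x \<partial>\<tau>) - (\<integral>x. f x \<partial>\<sigma>) + b \<le> p (A (f, b))"
    define V where "V = {u. bounded_measurable (M \<Otimes>\<^sub>M M) u}"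
    define K where "K = {f. bounded_measurable M f} \<times> (UNIV :: real set)"
    have V: "subspace V" unfolding V_def by (rule subspace_bounded_measurable)
    have p: "sublinear_on V p"
      unfolding V_def p_def by (rule sublinear_on_integral_pos_part[OF \<psi>])
    have K: "subspace K"
      unfolding K_def by (intro subspace_Times subspace_bounded_measurable) simp
    have AV: "A k \<in> V" if "k \<in> K" for k using that bA by (auto simp: K_def V_def)
    have Aadd: "A (k + l) = A k + A l" for k l
      by (cases k; cases l) (simp add: A_def fun_eq_iff algebra_simps)
    have Ascale: "A (c *\<^sub>R k) = c *\<^sub>R A k" for c k
      by (cases k) (simp add: A_def fun_eq_iff scaleR_fun_def algebra_simps)
    note int = integrable_bounded_measurable[OF \<sigma>] integrable_bounded_measurable[OF \<tau>]
    have Ladd: "L (k + l) = L k + L l" if "k \<in> K" "l \<in> K" for k l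
      using that by (cases k; cases l) (simp add: L_def K_def plus_fun_def int)
    have Lscale: "L (c *\<^sub>R k) = c * L k" for c k
      by (cases k) (simp add: L_def scaleR_fun_def algebra_simps)
    have unit: "L (f, b) \<le> p (A (f, b))" if "bounded_measurable M f" "b \<in> {-1, 0, 1}" for f b
      using R that by (simp add: L_def)
    have dom: "L k \<le> p (A k)" if k: "k \<in> K" for k
    proof -
      obtain f b where kfb: "k = (f, b)" and f: "bounded_measurable M f" using k by (auto simp: K_def)
      show ?thesis
      proof (cases "b = 0")
        case True
        with unit[OF f] show ?thesis by (simp add: kfb)
      next
        case False
        \<comment> \<open>Dividing by \<open>\<bar>b\<bar>\<close> brings the second coordinate to 1
          or -1, where the assumption applies; \<open>L\<close> and \<open>p\<close> are positively
          homogeneous, so the inequality scales back to \<open>k\<close>.\<close>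
        define l where "l = ((inverse \<bar>b\<bar>) *\<^sub>R f, sgn b)"
        have bl: "bounded_measurable M ((inverse \<bar>b\<bar>) *\<^sub>R f)"
          unfolding scaleR_fun_real using f by (rule bounded_measurable_cmult)
        have "L l \<le> p (A l)"
          unfolding l_def using bl by (rule unit) (auto simp: sgn_if)
        moreover have "l \<in> K" using bl by (simp add: l_def K_def)
        moreover have "k = \<bar>b\<bar> *\<^sub>R l"
          using False by (simp add: l_def kfb abs_mult_sgn)
        ultimately show ?thesis
          by (simp add: Lscale Ascale sublinear_on_scale[OF V p] AV mult_left_mono)
      qed
    qed
    obtain m where mp: "\<And>u. u \<in> V \<Longrightarrow> m u \<le> p u"
      and madd: "\<And>u w. u \<in> V \<Longrightarrow> w \<in> V \<Longrightarrow> m (u + w) = m u + m w"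
      and mscale: "\<And>c u. u \<in> V \<Longrightarrow> m (c *\<^sub>R u) = c * m u"
      and mA: "\<And>k. k \<in> K \<Longrightarrow> m (A k) = L k"
      by (rule mazur_orlicz[OF V p K, of A L]) (simp add: AV Aadd Ascale Ladd Lscale dom | blast)+
    obtain \<phi> where \<phi>: "finite_measure_on (M \<Otimes>\<^sub>M M) \<phi>" and le: "setwise_le \<phi> \<psi>"
      and int_\<phi>: "\<And>u. bounded_measurable (M \<Otimes>\<^sub>M M) u \<Longrightarrow> (\<integral>z. u z \<partial>\<phi>) = m u"
      by (rule dominated_functional_measure[OF \<psi>, of m])
        (use madd mscale mp in \<open>auto simp: V_def p_def plus_fun_def scaleR_fun_real\<close>)
    have val: "(\<integral>z. A (f, b) z \<partial>\<phi>) = L (f, b)" if "bounded_measurable M f" for f b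
      using int_\<phi>[OF bA[OF that]] mA[of "(f, b)"] that by (simp add: K_def)
    \<comment> \<open>The pair \<open>(0, 1)\<close> is sent by \<open>A\<close> to \<open>v\<close>
      and by \<open>L\<close> to 1.\<close>
    have "(\<integral>z. v z \<partial>\<phi>) = 1"
      using val[OF bounded_measurableI[of "\<lambda>x. 0" M 0], of 1] by (simp add: A_def L_def)
    moreover have "flow M \<sigma> \<tau> \<phi>"
      unfolding flow_def
    proof (intro conjI ballI \<phi>)
      interpret finite_measure \<phi> using \<phi> by (simp add: finite_measure_on_def)
      fix B assume B: "B \<in> sets M"
      note sp = finite_measure_on_space[OF \<phi>] space_pair_measure
      have sets: "sets \<phi> = sets (M \<Otimes>\<^sub>M M)" using \<phi> by (simp add: finite_measure_on_def)
      have BM: "B \<subseteq> space M" using B by (rule sets.sets_into_space)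
      \<comment> \<open>At the pair \<open>(indicator B, 0)\<close> the value of \<open>L\<close> is
        the \<open>\<tau>\<close>-measure minus the \<open>\<sigma>\<close>-measure of
        \<open>B\<close>, while the integral of \<open>A\<close> is the second marginal of
        \<open>\<phi>\<close> minus the first: the flow identity up to sign.\<close>
      have "(\<integral>z. A (indicator B, 0) z \<partial>\<phi>) = (\<integral>z. indicator (space M \<times> B) z - indicator (B \<times> space M) z \<partial>\<phi>)"
        by (intro Bochner_Integration.integral_cong) (auto simp: A_def indicator_def sp)
      also have "\<dots> = measure \<phi> (space M \<times> B) - measure \<phi> (B \<times> space M)"
        using B BM sets by (simp add: sp Int_absorb2 Sigma_mono less_top[symmetric])
      finally show "measure \<phi> (B \<times> space M) - measure \<phi> (space M \<times> B) = measure \<sigma> B - measure \<tau> B"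
        using val[OF bounded_measurable_indicator[OF B], of 0] BM
        by (simp add: L_def finite_measure_on_space[OF \<sigma>] finite_measure_on_space[OF \<tau>] Int_absorb2)
    qed
    ultimately show "\<exists>\<phi>. flow M \<sigma> \<tau> \<phi> \<and> setwise_le \<phi> \<psi> \<and> (\<integral>p. v p \<partial>\<phi>) = 1" using le by blast
  qed
qed

end
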